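(* Let $X$ be a topological space. The following are equivalent: (1) $X$ is submaximal. (2) Every locally dense subset of $X$ is an $\mathcal{AB}$-set. (3) Every dense subset of $X$ is an $\mathcal{AB}$-set.
   Context: For a subset $A$ of a topological space $X$, $\mathrm{Int}\,A$ denotes the interior and $\overline{A}$ the closure of $A$ in $X$. $A$ is semi-open if $A \subseteq \overline{\mathrm{Int}\,A}$; semi-closed if its complement is semi-open; semi-regular if it is both semi-open and semi-closed. $A$ is an $\mathcal{AB}$-set if $A = U \cap V$ with $U$ open and $V$ semi-regular. $A$ is locally dense (= preopen) if $A \subseteq \mathrm{Int}\,\overline{A}$. A space $X$ is submaximal if every dense subset of $X$ is open. No separation axioms are assumed. *)

theory Defs
  imports "HOL-Analysis.Abstract_Topology"
begin

text \<open>
  A space is an arbitrary \<^typ>\<open>'a topology\<close>; no separation axiom is imposed and the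
  empty space is allowed. The library's \<^const>\<open>closure_of\<close> and \<^const>\<open>interior_of\<close>
  accept arguments reaching outside the carrier, so each predicate on subsets
  includes the requirement \<open>A \<subseteq> topspace X\<close>, explicitly or through its parts.
\<close>

definition dense_subset :: "'a topology \<Rightarrow> 'a set \<Rightarrow> bool"
  where "dense_subset X A \<longleftrightarrow> A \<subseteq> topspace X \<and> X closure_of A = topspace X"

definition semi_open :: "'a topology \<Rightarrow> 'a set \<Rightarrow> bool"
  where "semi_open X A \<longleftrightarrow> A \<subseteq> topspace X \<and> A \<subseteq> X closure_of (X interior_of A)"

definition semi_closed :: "'a topology \<Rightarrow> 'a set \<Rightarrow> bool"
  where "semi_closed X A \<longleftrightarrow> A \<subseteq> topspace X \<and> semi_open X (topspace X - A)"

definition semi_regular :: "'a topology \<Rightarrow> 'a set \<Rightarrow> bool"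
  where "semi_regular X A \<longleftrightarrow> semi_open X A \<and> semi_closed X A"

definition AB_set :: "'a topology \<Rightarrow> 'a set \<Rightarrow> bool"
  where "AB_set X A \<longleftrightarrow> (\<exists>U V. openin X U \<and> semi_regular X V \<and> A = U \<inter> V)"

definition locally_dense :: "'a topology \<Rightarrow> 'a set \<Rightarrow> bool"
  where "locally_dense X A \<longleftrightarrow> A \<subseteq> topspace X \<and> A \<subseteq> X interior_of (X closure_of A)"

definition submaximal_space :: "'a topology \<Rightarrow> bool"
  where "submaximal_space X \<longleftrightarrow> (\<forall>A. dense_subset X A \<longrightarrow> openin X A)"

end

theory Submission
  imports Defs
begin

text \<open>
  A locally dense set \<open>A\<close> is the intersection of the open set \<open>Int (cl A)\<close> with the dense set
  \<open>A \<union> (X - cl A)\<close>, so in a submaximal space it is open. Conversely, the only dense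
  semi-closed set is the whole space, because its complement has empty interior; hence a dense
  AB-set \<open>U \<inter> V\<close> equals \<open>U\<close>.
\<close>

lemma dense_subset_mono:
  assumes "dense_subset X A" "A \<subseteq> B" "B \<subseteq> topspace X"
  shows "dense_subset X B"
  using assms closure_of_mono[of A B X] closure_of_subset_topspace[of X B]
  unfolding dense_subset_def by auto

lemma dense_imp_locally_dense: "dense_subset X A \<Longrightarrow> locally_dense X A"
  unfolding dense_subset_def locally_dense_def by simp

text \<open>Closure distributes over the union, so the result contains both
  \<open>X closure_of A\<close> and its complement.\<close>

lemma dense_subset_Un_complement_closure:
  assumes "A \<subseteq> topspace X"
  shows "dense_subset X (A \<union> (topspace X - X closure_of A))"
proof -
  have "topspace X - X closure_of A \<subseteq> X closure_of (topspace X - X closure_of A)"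
    by (intro closure_of_subset) auto
  then have "topspace X \<subseteq> X closure_of (A \<union> (topspace X - X closure_of A))"
    unfolding closure_of_Un by blast
  then show ?thesis
    using assms closure_of_subset_topspace[of X] unfolding dense_subset_def by fast
qed

lemma submaximal_locally_dense_imp_openin:
  assumes "submaximal_space X" "locally_dense X A"
  shows "openin X A"
proof -
  let ?D = "A \<union> (topspace X - X closure_of A)"
  have "openin X ?D"
    using assms dense_subset_Un_complement_closure
    unfolding submaximal_space_def locally_dense_def by blast
  \<comment> \<open>The added piece misses the closure of \<open>A\<close>, so the intersection
    keeps only points of \<open>A\<close>; local density ensures that none is lost.\<close>
  moreover have "A = X interior_of (X closure_of A) \<inter> ?D"
    using assms(2) interior_of_subset[of X "X closure_of A"]
    unfolding locally_dense_def by blast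
  ultimately show ?thesis
    by (metis openin_Int openin_interior_of)
qed

lemma openin_imp_AB_set:
  assumes "openin X A"
  shows "AB_set X A"
proof -
  have "semi_regular X (topspace X)"
    unfolding semi_regular_def semi_closed_def semi_open_def by simp
  moreover have "A = A \<inter> topspace X"
    using openin_subset[OF assms] by blast
  ultimately show ?thesis
    using assms unfolding AB_set_def by blast
qed

lemma dense_semi_closed_eq_topspace:
  assumes "dense_subset X V" "semi_closed X V"
  shows "V = topspace X"
proof -
  have "X interior_of (topspace X - V) = {}"
    using assms(1) unfolding dense_subset_def interior_of_complement by simp
  \<comment> \<open>The complement of \<open>V\<close> is semi-open, so it lies in the closure of
    its empty interior.\<close>
  then show ?thesis
    using assms(2) unfolding semi_closed_def semi_open_def by auto
qed

lemma dense_AB_set_imp_openin: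
  assumes "dense_subset X A" "AB_set X A"
  shows "openin X A"
proof -
  obtain U V where UV: "openin X U" "semi_regular X V" "A = U \<inter> V"
    using assms(2) unfolding AB_set_def by blast
  then have V: "semi_closed X V" "V \<subseteq> topspace X"
    unfolding semi_regular_def semi_closed_def by auto
  \<comment> \<open>\<open>V\<close> inherits density from its subset \<open>A\<close>.\<close>
  then have "V = topspace X"
    using dense_subset_mono[OF assms(1)] UV(3) dense_semi_closed_eq_topspace by blast
  then show ?thesis
    using UV by auto
qed

theorem theorem3p2:
  fixes X :: "'a topology"
  shows "(submaximal_space X \<longleftrightarrow> (\<forall>A. locally_dense X A \<longrightarrow> AB_set X A)) \<and>
         ((\<forall>A. locally_dense X A \<longrightarrow> AB_set X A) \<longleftrightarrow> (\<forall>A. dense_subset X A \<longrightarrow> AB_set X A))"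
  \<comment> \<open>The implications close a cycle (1), (2), (3), (1), with openness linking
    submaximality to AB-sets at both ends.\<close>
  using submaximal_locally_dense_imp_openin openin_imp_AB_set dense_imp_locally_dense
    dense_AB_set_imp_openin
  unfolding submaximal_space_def by metis

end
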